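(* Consider the $n$-agent mean-field games $\mathcal{G}_n$, $n\ge2$, with action interval $[a,b]$, utility family $u$ and deterministic parameters $(\alpha_i)_{i\ge 1}$ described in the context, whose best response function $\mathrm{Br}$ is Lipschitz in $z$ with constant $L_z<1$ and Lipschitz in $\alpha$ with constant $L$. Let $z^\star_{i,n}$ be the equilibrium mean variable of agent $i$ at the Nash equilibrium of $\mathcal{G}_n$, and let $\hat z^\star_{n,\rm AEM}$ be the solution of the $P_n(\alpha)$-based approximation, i.e. of $\hat z^\star_{n,\rm AEM}=\frac1n\sum_{i=1}^n\mathrm{Br}(\hat z^\star_{n,\rm AEM},\alpha_i)$. Then, as $n\to\infty$, $$\max_{1\le i\le n}\left|\hat z^\star_{n,\rm AEM}-z^\star_{i,n}\right|=O\!\left(\frac1n\right).$$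
   Context: Game. Let $a\le b$ be reals, $u:[a,b]\times\mathbb{R}\times\mathbb{R}\to\mathbb{R}$ a function, and $(\alpha_i)_{i\ge1}$ a deterministic sequence of reals (no convergence of its empirical distributions is assumed). For $n\ge 2$, $\mathcal{G}_n$ is the non-cooperative game with agents $1,\dots,n$ in which agent $i$ chooses an action $x_i\in[a,b]$ and maximizes the utility $u(x_i,z_{i,n},\alpha_i)$, where $z_{i,n}=\frac{1}{n-1}\sum_{j\ne i}x_j$ is the mean variable of agent $i$. Best response. $\mathrm{Br}(z,\alpha)=\arg\max_{a\le x\le b}u(x,z,\alpha)$; for all $z,\alpha\in\mathbb{R}$ the maximizer is assumed to exist and be unique, so $\mathrm{Br}:\mathbb{R}\times\mathbb{R}\to[a,b]$ is a function. Assumptions. (1) There is a constant $0<L_z<1$ with $|\mathrm{Br}(z,\alpha)-\mathrm{Br}(z',\alpha)|\le L_z|z-z'|$ for all $z,z',\alpha\in\mathbb{R}$. (2) There is a constant $L>0$ with $|\mathrm{Br}(z,\alpha)-\mathrm{Br}(z,\alpha')|\le L|\alpha-\alpha'|$ for all $z,\alpha,\alpha'\in\mathbb{R}$. Nash equilibrium. A Nash equilibrium of $\mathcal{G}_n$ is $(x^\star_{1,n},\dots,x^\star_{n,n})\in[a,b]^n$ with $x^\star_{i,n}=\mathrm{Br}(z^\star_{i,n},\alpha_i)$ for all $i$, where $z^\star_{i,n}=\frac{1}{n-1}\sum_{j\ne i}x^\star_{j,n}$. Under the assumptions it exists and is unique. $P_n(\alpha)$-based approximation. $P_n(\alpha)=\frac1n\sum_{i=1}^n\mathbf{1}\{\alpha_i\le\alpha\}$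 is the empirical distribution function, and $\hat z^\star_{n,\rm AEM}$ is the (unique) solution $z$ of $z=\frac1n\sum_{i=1}^n\mathrm{Br}(z,\alpha_i)$. *)

theory Defs
  imports Complex_Main "HOL-Library.FuncSet" "HOL-Library.Landau_Symbols"
begin

text \<open>
  Agents are numbered from 1, so a parameter sequence \<open>\<alpha> :: nat \<Rightarrow> real\<close> is used only at
  positive indices. The utility \<open>u\<close> is a total function, but its first argument only
  ever ranges over the action interval \<open>{a..b}\<close>.
\<close>

definition Br :: "real \<Rightarrow> real \<Rightarrow> (real \<Rightarrow> real \<Rightarrow> real \<Rightarrow> real) \<Rightarrow> real \<Rightarrow> real \<Rightarrow> real" where
  "Br a b u z \<alpha> = arg_max_on (\<lambda>x. u x z \<alpha>) {a..b}"

definition mean_var :: "nat \<Rightarrow> (nat \<Rightarrow> real) \<Rightarrow> nat \<Rightarrow> real" where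
  "mean_var n x i = 1 / (real n - 1) * (\<Sum>j\<in>{1..n} - {i}. x j)"

text \<open>
  Action profiles in $[a,b]^n$ are extensional functions on \<open>{1..n}\<close>, so that two
  profiles are equal iff they agree on the agents; uniqueness of the equilibrium is
  then meaningful for the definite description below.
\<close>

definition nash_equilibrium ::
  "real \<Rightarrow> real \<Rightarrow> (real \<Rightarrow> real \<Rightarrow> real \<Rightarrow> real) \<Rightarrow> (nat \<Rightarrow> real) \<Rightarrow> nat \<Rightarrow> (nat \<Rightarrow> real) \<Rightarrow> bool" where
  "nash_equilibrium a b u \<alpha> n x \<longleftrightarrow>
     x \<in> ({1..n} \<rightarrow>\<^sub>E {a..b}) \<and> (\<forall>i\<in>{1..n}. x i = Br a b u (mean_var n x i) (\<alpha> i))"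

definition x_star ::
  "real \<Rightarrow> real \<Rightarrow> (real \<Rightarrow> real \<Rightarrow> real \<Rightarrow> real) \<Rightarrow> (nat \<Rightarrow> real) \<Rightarrow> nat \<Rightarrow> nat \<Rightarrow> real" where
  "x_star a b u \<alpha> n = (THE x. nash_equilibrium a b u \<alpha> n x)"

definition z_star ::
  "real \<Rightarrow> real \<Rightarrow> (real \<Rightarrow> real \<Rightarrow> real \<Rightarrow> real) \<Rightarrow> (nat \<Rightarrow> real) \<Rightarrow> nat \<Rightarrow> nat \<Rightarrow> real" where
  "z_star a b u \<alpha> n i = mean_var n (x_star a b u \<alpha> n) i"

text \<open>
  The right-hand side of the fixed-point equation is the integral of
  \<open>Br a b u z\<close> against the empirical distribution of \<open>\<alpha> 1, \<dots>, \<alpha> n\<close>.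
\<close>

definition z_AEM ::
  "real \<Rightarrow> real \<Rightarrow> (real \<Rightarrow> real \<Rightarrow> real \<Rightarrow> real) \<Rightarrow> (nat \<Rightarrow> real) \<Rightarrow> nat \<Rightarrow> real" where
  "z_AEM a b u \<alpha> n = (THE z. z = 1 / real n * (\<Sum>i=1..n. Br a b u z (\<alpha> i)))"

end

theory Submission
  imports Defs "HOL-Analysis.Uniform_Limit"
begin

text \<open>
  Why the error is of order $1/n$. Let \<open>x\<close> be the equilibrium, \<open>m\<close> its average over all
  \<open>n\<close> agents, \<open>z\<^sub>i\<close> the mean variable of agent \<open>i\<close> and \<open>\<zeta>\<close> the fixed point of the
  averaged best response. Leaving one agent out of an average of \<open>n\<close> numbers from
  \<open>{a..b}\<close> moves it by at most \<open>(b - a) / (n - 1)\<close>, so every \<open>z\<^sub>i\<close> is that close to \<open>m\<close>.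
  Moreover \<open>\<zeta>\<close> and \<open>m\<close> are averages of the same best responses, evaluated at \<open>\<zeta>\<close> and
  at the \<open>z\<^sub>j\<close> respectively, so \<open>\<bar>\<zeta> - m\<bar> \<le> L\<^sub>z D\<close> with \<open>D = max\<^sub>j \<bar>\<zeta> - z\<^sub>j\<bar>\<close>. Together,
  \<open>D \<le> L\<^sub>z D + (b - a) / (n - 1)\<close>, and \<open>L\<^sub>z < 1\<close> lets this be solved for \<open>D\<close>:
  this is \<open>fixed_point_near_equilibrium_means\<close>.

  As both objects are given by definite descriptions, the argument needs them to exist and
  to be unique. Each is the fixed point of a contraction: of the line for
  \<open>z_AEM\<close>, and of the space of profiles with the supremum distance for the Nash equilibrium,
  since taking mean variables does not increase that distance.
\<close>

section \<open>Averages\<close>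

lemma average_dist_le:
  fixes f g :: "'a \<Rightarrow> real"
  assumes "\<And>j. j \<in> A \<Longrightarrow> \<bar>f j - g j\<bar> \<le> e" and "real (card A) = r" "0 < r"
  shows "\<bar>1 / r * sum f A - 1 / r * sum g A\<bar> \<le> e"
proof -
  have "\<bar>sum f A - sum g A\<bar> \<le> (\<Sum>j\<in>A. \<bar>f j - g j\<bar>)"
    by (simp add: sum_subtractf[symmetric])
  also have "\<dots> \<le> r * e"
    using sum_bounded_above[of A "\<lambda>j. \<bar>f j - g j\<bar>" e] assms by simp
  finally have "\<bar>sum f A - sum g A\<bar> \<le> r * e" .
  then have "\<bar>(sum f A - sum g A) / r\<bar> \<le> e"
    using \<open>0 < r\<close> by (simp add: abs_divide divide_le_eq mult.commute)
  then show ?thesis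
    by (simp add: diff_divide_distrib)
qed

lemma mean_var_dist_le:
  assumes "2 \<le> n" "i \<in> {1..n}" and "\<And>j. j \<in> {1..n} \<Longrightarrow> \<bar>x j - y j\<bar> \<le> e"
  shows "\<bar>mean_var n x i - mean_var n y i\<bar> \<le> e"
  unfolding mean_var_def
  by (rule average_dist_le) (use assms in \<open>auto simp: of_nat_diff\<close>)

text \<open>
  The full average \<open>m\<close> and the leave-one-out average satisfy
  \<open>(n - 1) (m - mean_var n x i) = x i - m\<close>, and both \<open>x i\<close> and \<open>m\<close> lie in \<open>{a..b}\<close>.
\<close>

lemma mean_var_near_average:
  assumes "2 \<le> n" "i \<in> {1..n}" and range: "\<And>j. j \<in> {1..n} \<Longrightarrow> x j \<in> {a..b}"
  shows "\<bar>1 / real n * (\<Sum>j=1..n. x j) - mean_var n x i\<bar> \<le> (b - a) / (real n - 1)"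
proof -
  define m where "m = 1 / real n * (\<Sum>j=1..n. x j)"
  have n: "real n - 1 > 0" "real n > 0"
    using \<open>2 \<le> n\<close> by auto
  have sum_m: "(\<Sum>j=1..n. x j) = real n * m"
    using n by (simp add: m_def)
  have "real n * a \<le> (\<Sum>j=1..n. x j)" "(\<Sum>j=1..n. x j) \<le> real n * b"
    using sum_bounded_below[of "{1..n}" a x] sum_bounded_above[of "{1..n}" x b] range by auto
  then have "a \<le> m" "m \<le> b"
    using n unfolding sum_m by (simp_all only: mult_le_cancel_left_pos)
  moreover have "x i \<in> {a..b}"
    using range \<open>i \<in> {1..n}\<close> by blast
  ultimately have "\<bar>x i - m\<bar> \<le> b - a"
    by auto
  moreover have "m - mean_var n x i = (x i - m) / (real n - 1)"
  proof -
    have "(\<Sum>j\<in>{1..n} - {i}. x j) = real n * m - x i"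
      using \<open>i \<in> {1..n}\<close> unfolding sum_m[symmetric] by (simp add: sum_diff1)
    then have "mean_var n x i = (real n * m - x i) / (real n - 1)"
      by (simp add: mean_var_def)
    then show ?thesis
      using n by (simp add: field_simps)
  qed
  ultimately show ?thesis
    using n by (simp add: m_def abs_divide divide_right_mono)
qed

section \<open>Existence and uniqueness\<close>

text \<open>
  This is Banach's theorem for the supremum distance on functions. As all values of \<open>F\<close> are
  within \<open>B\<close> of each other, any two images under \<open>F ^^ Suc k\<close> are within \<open>c ^ k * B\<close>.
  Fixed points are such images for every \<open>k\<close>, so there is at most one; and the iterates
  form a uniform Cauchy sequence, whose limit is fixed.
\<close>

lemma sup_contraction_unique_fixed_point:
  fixes F :: "('i \<Rightarrow> 'b::complete_space) \<Rightarrow> 'i \<Rightarrow> 'b"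
  assumes "0 \<le> c" "c < 1"
    and diameter: "\<And>x y i. dist (F x i) (F y i) \<le> B"
    and contr: "\<And>x y e i. (\<And>j. dist (x j) (y j) \<le> e) \<Longrightarrow> dist (F x i) (F y i) \<le> c * e"
  shows "\<exists>!x. F x = x"
proof -
  have iterates_close: "dist ((F ^^ k) (F x) i) ((F ^^ k) (F y) i) \<le> c ^ k * B" for k x y i
    by (induction k arbitrary: i) (simp_all add: diameter contr mult.assoc)
  have decay: "(\<lambda>k. c ^ k * B) \<longlonglongrightarrow> 0"
    using \<open>0 \<le> c\<close> \<open>c < 1\<close> by (intro tendsto_mult_left_zero LIMSEQ_realpow_zero)
  \<comment> \<open>The starting point is arbitrary; one application of \<open>F\<close> makes \<open>diameter\<close> available.\<close>
  define X where "X k = (F ^^ k) (F (\<lambda>_. undefined))" for k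
  have F_X: "F (X k) = X (Suc k)" for k
    by (simp add: X_def)
  have "uniformly_Cauchy_on UNIV X"
  proof (rule uniformly_Cauchy_onI')
    fix e :: real
    assume "e > 0"
    then have "\<forall>\<^sub>F k in sequentially. c ^ k * B < e"
      using decay by (rule order_tendstoD(2)[rotated])
    then obtain M where M: "\<And>k. k \<ge> M \<Longrightarrow> c ^ k * B < e"
      by (auto simp: eventually_sequentially)
    have "dist (X m i) (X n i) < e" if "m \<ge> M" "n > m" for m n i
    proof -
      obtain l where "n = m + Suc l"
        using less_imp_Suc_add[OF \<open>n > m\<close>] by auto
      then have "X n = (F ^^ m) (F (X l))"
        unfolding F_X by (simp add: X_def funpow_add funpow_swap1)
      then have "dist (X m i) (X n i) \<le> c ^ m * B"
        using iterates_close by (simp add: X_def)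
      also have "\<dots> < e"
        using M \<open>m \<ge> M\<close> .
      finally show ?thesis .
    qed
    then show "\<exists>M. \<forall>i\<in>UNIV. \<forall>m\<ge>M. \<forall>n>m. dist (X m i) (X n i) < e"
      by blast
  qed
  then obtain x where x: "uniform_limit UNIV X x sequentially"
    using Cauchy_uniformly_convergent uniformly_convergent_on_def by blast
  show ?thesis
  proof (rule ex1I[of _ x])
    show "F x = x"
    proof
      fix i
      have "(\<lambda>k. X (Suc k) i) \<longlonglongrightarrow> F x i"
      proof (rule tendstoI)
        fix e :: real
        assume "e > 0"
        have "\<forall>\<^sub>F k in sequentially. \<forall>j\<in>UNIV. dist (X k j) (x j) < e"
          using uniform_limitD[OF x \<open>e > 0\<close>] .
        then show "\<forall>\<^sub>F k in sequentially. dist (X (Suc k) i) (F x i) < e"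
        proof eventually_elim
          case (elim k)
          then have "dist (F (X k) i) (F x i) \<le> c * e"
            by (intro contr) (simp add: less_imp_le)
          also have "\<dots> < e"
            using \<open>c < 1\<close> \<open>e > 0\<close> by simp
          finally show ?case
            by (simp add: F_X)
        qed
      qed
      moreover have "(\<lambda>k. X (Suc k) i) \<longlonglongrightarrow> x i"
        by (intro LIMSEQ_Suc tendsto_uniform_limitI[OF x]) simp
      ultimately show "F x i = x i"
        by (rule LIMSEQ_unique)
    qed
    have fixed_iterate: "(F ^^ k) (F z) = z" if "F z = z" for z k
      using that by (induction k) simp_all
    fix y
    assume "F y = y"
    show "y = x"
    proof
      fix i
      have "dist (y i) (x i) \<le> c ^ k * B" for k
        using iterates_close[of k y i x] fixed_iterate \<open>F y = y\<close> \<open>F x = x\<close> by simp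
      then have "dist (y i) (x i) \<le> 0"
        by (intro tendsto_lowerbound[OF decay]) simp_all
      then show "y i = x i"
        by simp
    qed
  qed
qed

lemma Br_in_interval:
  assumes "\<exists>x. is_arg_max (\<lambda>x. u x z c) (\<lambda>x. x \<in> {a..b}) x"
  shows "Br a b u z c \<in> {a..b}"
  using someI_ex[OF assms] unfolding Br_def arg_max_on_def arg_max_def is_arg_max_def by blast

text \<open>
  An equilibrium is a fixed point of the simultaneous best response. Restricting the latter
  to \<open>{1..n}\<close> gives all responses the same value at every other index, so there the
  distance is zero and the contraction property holds at all indices.
\<close>

lemma nash_equilibrium_unique:
  assumes range: "\<And>z c. Br a b u z c \<in> {a..b}"
    and "0 \<le> q" "q < 1"
    and lip: "\<And>z z' c. \<bar>Br a b u z c - Br a b u z' c\<bar> \<le> q * \<bar>z - z'\<bar>"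
    and "2 \<le> n"
  shows "\<exists>!x. nash_equilibrium a b u \<alpha> n x"
proof -
  define F where "F x = restrict (\<lambda>i. Br a b u (mean_var n x i) (\<alpha> i)) {1..n}" for x
  have "F x = x \<longleftrightarrow> nash_equilibrium a b u \<alpha> n x" for x
  proof
    assume "F x = x"
    moreover have "F x \<in> {1..n} \<rightarrow>\<^sub>E {a..b}"
      using range by (simp add: F_def PiE_def Pi_def)
    moreover have "\<forall>i\<in>{1..n}. F x i = Br a b u (mean_var n x i) (\<alpha> i)"
      by (simp add: F_def)
    ultimately show "nash_equilibrium a b u \<alpha> n x"
      by (simp add: nash_equilibrium_def)
  next
    assume "nash_equilibrium a b u \<alpha> n x"
    then show "F x = x"
      unfolding nash_equilibrium_def F_def
      by (intro ext) (auto simp: restrict_def PiE_def extensional_def)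
  qed
  moreover have "\<exists>!x. F x = x"
  proof (rule sup_contraction_unique_fixed_point[OF \<open>0 \<le> q\<close> \<open>q < 1\<close>])
    fix x y i
    show "dist (F x i) (F y i) \<le> b - a"
      using range[of "mean_var n x i" "\<alpha> i"] range[of "mean_var n y i" "\<alpha> i"]
      by (cases "i \<in> {1..n}") (auto simp: F_def dist_real_def)
  next
    fix x y :: "nat \<Rightarrow> real" and e i
    assume e: "\<And>j. dist (x j) (y j) \<le> e"
    have "0 \<le> e"
      using e[of i] zero_le_dist[of "x i" "y i"] by linarith
    show "dist (F x i) (F y i) \<le> q * e"
    proof (cases "i \<in> {1..n}")
      case True
      have "\<bar>mean_var n x i - mean_var n y i\<bar> \<le> e"
        using mean_var_dist_le[OF \<open>2 \<le> n\<close> True] e by (simp add: dist_real_def)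
      then have "q * \<bar>mean_var n x i - mean_var n y i\<bar> \<le> q * e"
        using \<open>0 \<le> q\<close> by (rule mult_left_mono)
      with True show ?thesis
        using lip[of "mean_var n x i" "\<alpha> i" "mean_var n y i"]
        by (simp add: F_def dist_real_def)
    next
      case False
      then show ?thesis
        unfolding F_def restrict_apply if_not_P[OF False]
        using \<open>0 \<le> q\<close> \<open>0 \<le> e\<close> by simp
    qed
  qed
  ultimately show ?thesis
    by simp
qed

lemma averaged_contraction_unique_fixed_point:
  fixes f :: "real \<Rightarrow> nat \<Rightarrow> real"
  assumes "0 \<le> q" "q < 1" "1 \<le> n"
    and lip: "\<And>z z' i. \<bar>f z i - f z' i\<bar> \<le> q * \<bar>z - z'\<bar>"
  shows "\<exists>!z. z = 1 / real n * (\<Sum>i=1..n. f z i)"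
proof -
  define F where "F z = 1 / real n * (\<Sum>i=1..n. f z i)" for z
  have "dist (F z) (F z') \<le> q * dist z z'" for z z'
    unfolding F_def dist_real_def
    by (rule average_dist_le) (use lip \<open>1 \<le> n\<close> in auto)
  then have "\<exists>!z. F z = z"
    using \<open>0 \<le> q\<close> \<open>q < 1\<close> by (intro banach_fix_type) auto
  then have "\<exists>!z. z = F z"
    by metis
  then show ?thesis
    by (simp only: F_def)
qed

section \<open>The approximation error\<close>

lemma fixed_point_near_equilibrium_means:
  assumes "q < 1" "0 \<le> q" "2 \<le> n"
    and lip: "\<And>z z' c. \<bar>Br a b u z c - Br a b u z' c\<bar> \<le> q * \<bar>z - z'\<bar>"
    and nash: "nash_equilibrium a b u \<alpha> n x"
    and fixed: "\<zeta> = 1 / real n * (\<Sum>i=1..n. Br a b u \<zeta> (\<alpha> i))"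
  shows "Max ((\<lambda>i. \<bar>\<zeta> - mean_var n x i\<bar>) ` {1..n}) \<le> (b - a) / ((1 - q) * (real n - 1))"
    (is "?D \<le> _")
proof -
  have x: "x i \<in> {a..b}" "x i = Br a b u (mean_var n x i) (\<alpha> i)" if "i \<in> {1..n}" for i
    using nash that unfolding nash_equilibrium_def by blast+
  define m where "m = 1 / real n * (\<Sum>j=1..n. x j)"
  have "\<bar>\<zeta> - m\<bar> \<le> q * ?D"
  proof -
    have "\<bar>1 / real n * (\<Sum>i=1..n. Br a b u \<zeta> (\<alpha> i)) - 1 / real n * (\<Sum>j=1..n. x j)\<bar> \<le> q * ?D"
    proof (rule average_dist_le)
      fix j
      assume j: "j \<in> {1..n}"
      have "\<bar>Br a b u \<zeta> (\<alpha> j) - x j\<bar> \<le> q * \<bar>\<zeta> - mean_var n x j\<bar>"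
        using lip[of \<zeta> "\<alpha> j" "mean_var n x j"] x(2)[OF j] by simp
      also have "\<dots> \<le> q * ?D"
        using j \<open>0 \<le> q\<close> by (intro mult_left_mono Max_ge) auto
      finally show "\<bar>Br a b u \<zeta> (\<alpha> j) - x j\<bar> \<le> q * ?D" .
    qed (use \<open>2 \<le> n\<close> in auto)
    then show ?thesis
      by (simp only: m_def fixed[symmetric])
  qed
  moreover have "\<bar>m - mean_var n x i\<bar> \<le> (b - a) / (real n - 1)" if "i \<in> {1..n}" for i
    unfolding m_def using mean_var_near_average[OF \<open>2 \<le> n\<close> that] x(1) by blast
  ultimately have "\<bar>\<zeta> - mean_var n x i\<bar> \<le> q * ?D + (b - a) / (real n - 1)" if "i \<in> {1..n}" for i
    using that by (smt (verit))
  then have "?D \<le> q * ?D + (b - a) / (real n - 1)"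
    using \<open>2 \<le> n\<close> by (subst Max_le_iff) auto
  then have "(1 - q) * ?D \<le> (b - a) / (real n - 1)"
    by (simp add: algebra_simps)
  then have "?D \<le> (b - a) / (real n - 1) / (1 - q)"
    using \<open>q < 1\<close> by (simp only: pos_le_divide_eq mult.commute diff_gt_0_iff_gt)
  then show ?thesis
    by (simp add: mult.commute)
qed

theorem proposition3:
  fixes a b L\<^sub>z L :: real
    and u :: "real \<Rightarrow> real \<Rightarrow> real \<Rightarrow> real"
    and \<alpha> :: "nat \<Rightarrow> real"
  assumes "a \<le> b"
    and "\<And>z c. \<exists>!x. is_arg_max (\<lambda>x. u x z c) (\<lambda>x. x \<in> {a..b}) x"
    and "0 < L\<^sub>z" "L\<^sub>z < 1"
    and "\<And>z z' c. \<bar>Br a b u z c - Br a b u z' c\<bar> \<le> L\<^sub>z * \<bar>z - z'\<bar>"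
    and "0 < L"
    and "\<And>z c c'. \<bar>Br a b u z c - Br a b u z c'\<bar> \<le> L * \<bar>c - c'\<bar>"
  shows "(\<lambda>n. Max ((\<lambda>i. \<bar>z_AEM a b u \<alpha> n - z_star a b u \<alpha> n i\<bar>) ` {1..n})) \<in> O(\<lambda>n. 1 / real n)"
proof -
  have range: "Br a b u z c \<in> {a..b}" for z c
    using assms(2) by (intro Br_in_interval) blast
  have q: "0 \<le> L\<^sub>z"
    using \<open>0 < L\<^sub>z\<close> by simp
  \<comment> \<open>The factor 2 comes from \<open>n \<le> 2 (n - 1)\<close> for \<open>2 \<le> n\<close>.\<close>
  define C where "C = 2 * (b - a) / (1 - L\<^sub>z)"
  have "norm (Max ((\<lambda>i. \<bar>z_AEM a b u \<alpha> n - z_star a b u \<alpha> n i\<bar>) ` {1..n}))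
      \<le> C * norm (1 / real n)" if "2 \<le> n" for n
  proof -
    let ?D = "Max ((\<lambda>i. \<bar>z_AEM a b u \<alpha> n - z_star a b u \<alpha> n i\<bar>) ` {1..n})"
    have "nash_equilibrium a b u \<alpha> n (x_star a b u \<alpha> n)"
      unfolding x_star_def
      using theI'[OF nash_equilibrium_unique[OF range q \<open>L\<^sub>z < 1\<close> assms(5) that]] .
    moreover have "z_AEM a b u \<alpha> n = 1 / real n * (\<Sum>i=1..n. Br a b u (z_AEM a b u \<alpha> n) (\<alpha> i))"
    proof -
      have "\<exists>!z. z = 1 / real n * (\<Sum>i=1..n. Br a b u z (\<alpha> i))"
        by (rule averaged_contraction_unique_fixed_point[OF q \<open>L\<^sub>z < 1\<close> _ assms(5)])
          (use that in simp)
      from theI'[OF this] show ?thesis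
        unfolding z_AEM_def .
    qed
    ultimately have "?D \<le> (b - a) / ((1 - L\<^sub>z) * (real n - 1))"
      unfolding z_star_def
      by (rule fixed_point_near_equilibrium_means[OF \<open>L\<^sub>z < 1\<close> q that assms(5)])
    also have "\<dots> = (b - a) / (1 - L\<^sub>z) * (1 / (real n - 1))"
      by simp
    also have "\<dots> \<le> (b - a) / (1 - L\<^sub>z) * (2 / real n)"
      using that assms by (intro mult_left_mono) (auto simp: field_simps)
    also have "\<dots> = C * (1 / real n)"
      by (simp add: C_def)
    finally have "?D \<le> C * (1 / real n)" .
    moreover have "0 \<le> ?D"
      using that by (subst Max_ge_iff) auto
    ultimately show ?thesis
      by simp
  qed
  then show ?thesis
    by (intro bigoI[of _ C]) (auto simp: eventually_at_top_linorder)
qed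

end
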